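(* Let $E$ be a Banach space, let $S_{\mathcal A}:[0,\infty)\to\mathcal L(E)$ be strongly continuous and locally bounded with $S_{\mathcal A}(0)=I$, let $P_{\mathcal A}\in L^1((0,T);\mathcal L(E))$ for every $T>0$, and let $\mathcal N:E\to E$ be Lipschitz on bounded sets. For every $R,T>0$ there is a constant $C_{R,T}$ such that, whenever $u$ and $v$ are mild solutions on $[0,T]$ with initial values $u_0$ and $v_0$ and $\|u\|_{C([0,T];E)}+\|v\|_{C([0,T];E)}\le R$, one has $$\|u-v\|_{C([0,T];E)}\le C_{R,T}\,\|u_0-v_0\|_E .$$
   Context: $\mathcal L(E)$ is the space of bounded linear operators on $E$ with the operator norm. "Lipschitz on bounded sets" means: for every $R>0$ there is $L_R$ such that $\|\mathcal N(u)-\mathcal N(v)\|_E\le L_R\|u-v\|_E$ whenever $\|u\|_E,\|v\|_E\le R$. A mild solution on $[0,T]$ with initial value $u_0$ is a function $u\in C([0,T];E)$ satisfying $u(t)=S_{\mathcal A}(t)u_0+\int_0^tP_{\mathcal A}(t-s)\mathcal N(u(s))\,ds$ for all $t\in[0,T]$. The constant $C_{R,T}$ may depend on $S_{\mathcal A},P_{\mathcal A},\mathcal N$. *)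

theory Defs
  imports "HOL-Analysis.Analysis"
begin

text \<open>
  The library's Bochner integral is restricted to second countable target spaces. Here the target
  is an arbitrary Banach space (and, for \<open>P\<close>, a space of operators, which is
  rarely separable), so the Bochner theory is set up on top of the library's
  \<open>simple_bochner_integrable\<close> and \<open>simple_bochner_integral\<close>, which carry no such restriction.
\<close>

definition strongly_measurable :: "'m measure \<Rightarrow> ('m \<Rightarrow> 'b::real_normed_vector) \<Rightarrow> bool" where
  "strongly_measurable M f \<longleftrightarrow>
     (\<exists>s. (\<forall>i::nat. Bochner_Integration.simple_bochner_integrable M (s i)) \<and>
          (AE x in M. (\<lambda>i. s i x) \<longlonglongrightarrow> f x))"

text \<open>
  Membership of (a representative of) \<open>f\<close> in \<open>L\<^sup>1(M; 'b)\<close>.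
\<close>

definition in_L1 :: "'m measure \<Rightarrow> ('m \<Rightarrow> 'b::real_normed_vector) \<Rightarrow> bool" where
  "in_L1 M f \<longleftrightarrow>
     strongly_measurable M f \<and> (\<integral>\<^sup>+x. ennreal (norm (f x)) \<partial>M) < \<infinity>"

definition has_bochner_value ::
    "'m measure \<Rightarrow> ('m \<Rightarrow> 'b::real_normed_vector) \<Rightarrow> 'b \<Rightarrow> bool" where
  "has_bochner_value M f y \<longleftrightarrow>
     strongly_measurable M f \<and>
     (\<exists>s. (\<forall>i::nat. Bochner_Integration.simple_bochner_integrable M (s i)) \<and>
          (\<lambda>i. \<integral>\<^sup>+x. ennreal (norm (f x - s i x)) \<partial>M) \<longlonglongrightarrow> 0 \<and>
          (\<lambda>i. Bochner_Integration.simple_bochner_integral M (s i)) \<longlonglongrightarrow> y)"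

definition bochner_integral :: "'m measure \<Rightarrow> ('m \<Rightarrow> 'b::real_normed_vector) \<Rightarrow> 'b" where
  "bochner_integral M f = (THE y. has_bochner_value M f y)"

definition lipschitz_on_bounded_sets :: "('a::real_normed_vector \<Rightarrow> 'a) \<Rightarrow> bool" where
  "lipschitz_on_bounded_sets N \<longleftrightarrow>
     (\<forall>R>0. \<exists>L. \<forall>u v. norm u \<le> R \<longrightarrow> norm v \<le> R \<longrightarrow> norm (N u - N v) \<le> L * norm (u - v))"

definition strongly_continuous ::
    "(real \<Rightarrow> 'a::real_normed_vector \<Rightarrow>\<^sub>L 'a) \<Rightarrow> bool" where
  "strongly_continuous S \<longleftrightarrow> (\<forall>x. continuous_on {0..} (\<lambda>t. blinfun_apply (S t) x))"

definition locally_bounded_family ::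
    "(real \<Rightarrow> 'a::real_normed_vector \<Rightarrow>\<^sub>L 'a) \<Rightarrow> bool" where
  "locally_bounded_family S \<longleftrightarrow> (\<forall>T>0. bounded (S ` {0..T}))"

text \<open>
  The norm of \<open>C([0,T];E)\<close>; only meaningful for \<open>0 \<le> T\<close> and \<open>u\<close> continuous on \<open>[0,T]\<close>.
\<close>

definition C_norm :: "real \<Rightarrow> (real \<Rightarrow> 'a::real_normed_vector) \<Rightarrow> real" where
  "C_norm T u = (SUP t\<in>{0..T}. norm (u t))"

text \<open>
  The integral is taken over the open interval, so that only values of \<open>P\<close> on \<open>(0,T)\<close> enter.
\<close>

definition mild_solution ::
    "(real \<Rightarrow> 'a::banach \<Rightarrow>\<^sub>L 'a) \<Rightarrow> (real \<Rightarrow> 'a \<Rightarrow>\<^sub>L 'a) \<Rightarrow> ('a \<Rightarrow> 'a) \<Rightarrow>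
     real \<Rightarrow> 'a \<Rightarrow> (real \<Rightarrow> 'a) \<Rightarrow> bool" where
  "mild_solution S P N T u0 u \<longleftrightarrow>
     continuous_on {0..T} u \<and>
     (\<forall>t\<in>{0..T}. u t =
        blinfun_apply (S t) u0 +
        bochner_integral (lebesgue_on {0<..<t}) (\<lambda>s. blinfun_apply (P (t - s)) (N (u s))))"

end

theory Submission
  imports Defs
begin

text \<open>
  The difference of two mild solutions satisfies
  \<open>norm (u t - v t) \<le> M * norm (u0 - v0) + L * (\<integral>s\<in>{0<..<t}. norm (P (t - s)) * norm (u s - v s))\<close>,
  where \<open>M\<close> bounds \<open>S\<close> on \<open>[0,T]\<close> and \<open>L\<close> is a Lipschitz constant of \<open>N\<close> on the ball of radius \<open>R\<close>.
  By dominated convergence the kernel \<open>L * norm (P r) * exp (- n r)\<close> has mass at most \<open>1/2\<close> for large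
  \<open>n\<close>, so in the equivalent norm \<open>sup (exp (- n t) * norm (u t))\<close> the integral term is absorbed.
  The integrals exist because the integrand is the a.e. limit of simple functions obtained from a
  simple approximation of \<open>P\<close> and step functions approximating the continuous map \<open>N \<circ> u\<close>.
\<close>

section \<open>The Bochner integral in a nonseparable Banach space\<close>

lemma simple_bochner_integrable_diff:
  "Bochner_Integration.simple_bochner_integrable M s \<Longrightarrow>
   Bochner_Integration.simple_bochner_integrable M t \<Longrightarrow>
   Bochner_Integration.simple_bochner_integrable M (\<lambda>x. s x - t x)"
  by (rule simple_bochner_integrable_compose2) simp_all

lemma simple_bochner_integrable_imp_strongly_measurable:
  "Bochner_Integration.simple_bochner_integrable M s \<Longrightarrow> strongly_measurable M s"
  unfolding strongly_measurable_def by (rule exI[of _ "\<lambda>_. s"]) simp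

lemma strongly_measurable_diff:
  assumes "strongly_measurable M f" "strongly_measurable M g"
  shows "strongly_measurable M (\<lambda>x. f x - g x)"
proof -
  obtain s where s: "\<And>i. Bochner_Integration.simple_bochner_integrable M (s i)"
      "AE x in M. (\<lambda>i. s i x) \<longlonglongrightarrow> f x"
    using assms(1) unfolding strongly_measurable_def by blast
  obtain t where t: "\<And>i. Bochner_Integration.simple_bochner_integrable M (t i)"
      "AE x in M. (\<lambda>i. t i x) \<longlonglongrightarrow> g x"
    using assms(2) unfolding strongly_measurable_def by blast
  have "AE x in M. (\<lambda>i. s i x - t i x) \<longlonglongrightarrow> f x - g x"
    using s(2) t(2) by eventually_elim (rule tendsto_diff)
  then show ?thesis
    unfolding strongly_measurable_def using s(1) t(1)
    by (intro exI[of _ "\<lambda>i x. s i x - t i x"]) (auto intro: simple_bochner_integrable_diff)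
qed

lemma borel_measurable_norm_simple_bochner_integrable:
  fixes s :: "'m \<Rightarrow> 'b::real_normed_vector"
  assumes "Bochner_Integration.simple_bochner_integrable M s"
  shows "(\<lambda>x. ennreal (norm (s x))) \<in> borel_measurable M"
  using assms
  by (elim simple_bochner_integrable.cases) (intro borel_measurable_simple_function
      simple_function_compose1[where g="\<lambda>y. ennreal (norm y)"])

text \<open>Simple functions converge to \<open>f\<close> only almost everywhere, so
  \<open>f\<close> may be arbitrary on a null set; the liminf of their norms is a measurable version
  of its norm. Additivity and dominated convergence are applied to such versions.\<close>

lemma strongly_measurable_norm_AE_eq:
  fixes f :: "'m \<Rightarrow> 'b::real_normed_vector"
  assumes "strongly_measurable M f"
  obtains h where "h \<in> borel_measurable M" "AE x in M. ennreal (norm (f x)) = h x"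
proof -
  obtain s where s: "\<And>i::nat. Bochner_Integration.simple_bochner_integrable M (s i)"
        "AE x in M. (\<lambda>i. s i x) \<longlonglongrightarrow> f x"
    using assms unfolding strongly_measurable_def by metis
  note [measurable] = borel_measurable_norm_simple_bochner_integrable[OF s(1)]
  have "AE x in M. ennreal (norm (f x)) = liminf (\<lambda>i. ennreal (norm (s i x)))"
    using s(2)
  proof eventually_elim
    case (elim x)
    then have "(\<lambda>i. ennreal (norm (s i x))) \<longlonglongrightarrow> ennreal (norm (f x))"
      by (intro tendsto_ennrealI tendsto_norm)
    then show ?case
      by (intro lim_imp_Liminf[symmetric]) simp_all
  qed
  moreover have "(\<lambda>x. liminf (\<lambda>i. ennreal (norm (s i x)))) \<in> borel_measurable M"
    by measurable
  ultimately show ?thesis using that by blast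
qed

text \<open>Additivity is used on measurable versions of the two norms on the right; the passage
  from \<open>h\<close> to their sum is mere monotonicity.\<close>

lemma nn_integral_norm_triangle_le:
  fixes f g h :: "'m \<Rightarrow> 'b::real_normed_vector"
  assumes "strongly_measurable M f" "strongly_measurable M g"
    and le: "\<And>x. x \<in> space M \<Longrightarrow> norm (h x) \<le> norm (f x) + norm (g x)"
  shows "(\<integral>\<^sup>+x. ennreal (norm (h x)) \<partial>M)
    \<le> (\<integral>\<^sup>+x. ennreal (norm (f x)) \<partial>M) + (\<integral>\<^sup>+x. ennreal (norm (g x)) \<partial>M)"
proof -
  obtain a where [measurable]: "a \<in> borel_measurable M" and a: "AE x in M. ennreal (norm (f x)) = a x"
    using strongly_measurable_norm_AE_eq[OF assms(1)] .
  obtain b where [measurable]: "b \<in> borel_measurable M" and b: "AE x in M. ennreal (norm (g x)) = b x"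
    using strongly_measurable_norm_AE_eq[OF assms(2)] .
  have "(\<integral>\<^sup>+x. ennreal (norm (h x)) \<partial>M) \<le> (\<integral>\<^sup>+x. a x + b x \<partial>M)"
  proof (rule nn_integral_mono_AE)
    show "AE x in M. ennreal (norm (h x)) \<le> a x + b x"
      using a b AE_space
    proof eventually_elim
      case (elim x)
      have "ennreal (norm (h x)) \<le> ennreal (norm (f x)) + ennreal (norm (g x))"
        using le[OF elim(3)] by (simp flip: ennreal_plus)
      then show ?case using elim by simp
    qed
  qed
  also have "\<dots> = (\<integral>\<^sup>+x. a x \<partial>M) + (\<integral>\<^sup>+x. b x \<partial>M)"
    by (rule nn_integral_add) simp_all
  also have "(\<integral>\<^sup>+x. a x \<partial>M) = (\<integral>\<^sup>+x. ennreal (norm (f x)) \<partial>M)"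
    using a by (intro nn_integral_cong_AE) auto
  also have "(\<integral>\<^sup>+x. b x \<partial>M) = (\<integral>\<^sup>+x. ennreal (norm (g x)) \<partial>M)"
    using b by (intro nn_integral_cong_AE) auto
  finally show ?thesis .
qed

section \<open>Norm bound, differences and uniqueness of Bochner values\<close>

lemma norm_simple_bochner_integral_le:
  fixes s :: "'m \<Rightarrow> 'b::real_normed_vector"
  assumes s: "Bochner_Integration.simple_bochner_integrable M s"
  shows "ennreal (norm (Bochner_Integration.simple_bochner_integral M s))
    \<le> (\<integral>\<^sup>+x. ennreal (norm (s x)) \<partial>M)"
proof -
  have "ennreal (norm (Bochner_Integration.simple_bochner_integral M s))
      \<le> ennreal (Bochner_Integration.simple_bochner_integral M (\<lambda>x. norm (s x)))"
    by (intro ennreal_leI simple_bochner_integral_norm_bound s)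
  also have "\<dots> = (\<integral>\<^sup>+x. ennreal (norm (s x)) \<partial>M)"
    using simple_bochner_integrable_compose2[of "\<lambda>x y. norm x", OF _ s s]
    by (intro simple_bochner_integral_eq_nn_integral) simp_all
  finally show ?thesis .
qed

text \<open>The integral of \<open>s i\<close> has norm at most the integral of
  \<open>norm (f x)\<close> plus the mean distance from \<open>f\<close> to \<open>s i\<close>; the
  latter tends to 0, and the inequality passes to the limit.\<close>

lemma norm_has_bochner_value_le:
  assumes "has_bochner_value M f y"
  shows "ennreal (norm y) \<le> (\<integral>\<^sup>+x. ennreal (norm (f x)) \<partial>M)"
proof -
  obtain s where f: "strongly_measurable M f"
    and s: "\<And>i::nat. Bochner_Integration.simple_bochner_integrable M (s i)"
    and lim: "(\<lambda>i. \<integral>\<^sup>+x. ennreal (norm (f x - s i x)) \<partial>M) \<longlonglongrightarrow> 0"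
    and y: "(\<lambda>i. Bochner_Integration.simple_bochner_integral M (s i)) \<longlonglongrightarrow> y"
    using assms unfolding has_bochner_value_def by blast
  note sm = simple_bochner_integrable_imp_strongly_measurable[OF s]
  have "ennreal (norm (Bochner_Integration.simple_bochner_integral M (s i)))
    \<le> (\<integral>\<^sup>+x. ennreal (norm (f x)) \<partial>M) + (\<integral>\<^sup>+x. ennreal (norm (f x - s i x)) \<partial>M)" for i
  proof (rule order_trans[OF norm_simple_bochner_integral_le[OF s]],
      rule nn_integral_norm_triangle_le[OF f strongly_measurable_diff[OF f sm]])
    show "norm (s i x) \<le> norm (f x) + norm (f x - s i x)" for x
      using norm_triangle_ineq4[of "f x" "f x - s i x"] by simp
  qed
  moreover have "(\<lambda>i. ennreal (norm (Bochner_Integration.simple_bochner_integral M (s i))))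
      \<longlonglongrightarrow> ennreal (norm y)"
    by (intro tendsto_ennrealI tendsto_norm y)
  moreover have "(\<lambda>i. (\<integral>\<^sup>+x. ennreal (norm (f x)) \<partial>M) + (\<integral>\<^sup>+x. ennreal (norm (f x - s i x)) \<partial>M))
      \<longlonglongrightarrow> (\<integral>\<^sup>+x. ennreal (norm (f x)) \<partial>M) + 0"
    by (intro tendsto_add tendsto_const lim)
  ultimately have "ennreal (norm y) \<le> (\<integral>\<^sup>+x. ennreal (norm (f x)) \<partial>M) + 0"
    by (intro LIMSEQ_le) blast+
  then show ?thesis by simp
qed

text \<open>Serves both for uniqueness of the value and for subtracting the integral equations of
  two solutions.\<close>

lemma has_bochner_value_diff:
  assumes "has_bochner_value M f y" "has_bochner_value M g z"
  shows "has_bochner_value M (\<lambda>x. f x - g x) (y - z)"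
proof -
  obtain s where f: "strongly_measurable M f"
    and s: "\<And>i::nat. Bochner_Integration.simple_bochner_integrable M (s i)"
    and lims: "(\<lambda>i. \<integral>\<^sup>+x. ennreal (norm (f x - s i x)) \<partial>M) \<longlonglongrightarrow> 0"
    and y: "(\<lambda>i. Bochner_Integration.simple_bochner_integral M (s i)) \<longlonglongrightarrow> y"
    using assms(1) unfolding has_bochner_value_def by blast
  obtain t where g: "strongly_measurable M g"
    and t: "\<And>i::nat. Bochner_Integration.simple_bochner_integrable M (t i)"
    and limt: "(\<lambda>i. \<integral>\<^sup>+x. ennreal (norm (g x - t i x)) \<partial>M) \<longlonglongrightarrow> 0"
    and z: "(\<lambda>i. Bochner_Integration.simple_bochner_integral M (t i)) \<longlonglongrightarrow> z"
    using assms(2) unfolding has_bochner_value_def by blast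
  note sm = simple_bochner_integrable_imp_strongly_measurable
  have le: "(\<integral>\<^sup>+x. ennreal (norm (f x - g x - (s i x - t i x))) \<partial>M)
    \<le> (\<integral>\<^sup>+x. ennreal (norm (f x - s i x)) \<partial>M) + (\<integral>\<^sup>+x. ennreal (norm (g x - t i x)) \<partial>M)" for i
  proof (rule nn_integral_norm_triangle_le[OF
        strongly_measurable_diff[OF f sm[OF s]] strongly_measurable_diff[OF g sm[OF t]]])
    fix x
    have "f x - g x - (s i x - t i x) = (f x - s i x) - (g x - t i x)" by simp
    then show "norm (f x - g x - (s i x - t i x)) \<le> norm (f x - s i x) + norm (g x - t i x)"
      using norm_triangle_ineq4[of "f x - s i x" "g x - t i x"] by (rule ssubst)
  qed
  have sum: "(\<lambda>i. (\<integral>\<^sup>+x. ennreal (norm (f x - s i x)) \<partial>M) + (\<integral>\<^sup>+x. ennreal (norm (g x - t i x)) \<partial>M))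
      \<longlonglongrightarrow> 0"
    using tendsto_add[OF lims limt] by simp
  have "(\<lambda>i. \<integral>\<^sup>+x. ennreal (norm (f x - g x - (s i x - t i x))) \<partial>M) \<longlonglongrightarrow> 0"
  proof (rule tendsto_sandwich[OF _ _ tendsto_const sum])
    show "\<forall>\<^sub>F i in sequentially. (\<integral>\<^sup>+x. ennreal (norm (f x - g x - (s i x - t i x))) \<partial>M)
      \<le> (\<integral>\<^sup>+x. ennreal (norm (f x - s i x)) \<partial>M) + (\<integral>\<^sup>+x. ennreal (norm (g x - t i x)) \<partial>M)"
      by (rule always_eventually) (rule allI, rule le)
  qed simp
  moreover have "(\<lambda>i. Bochner_Integration.simple_bochner_integral M (\<lambda>x. s i x - t i x)) \<longlonglongrightarrow> y - z"
    using tendsto_diff[OF y z] by (simp add: simple_bochner_integral_diff s t)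
  ultimately show ?thesis
    unfolding has_bochner_value_def
    using strongly_measurable_diff[OF f g] simple_bochner_integrable_diff[OF s t]
    by (intro conjI exI[of _ "\<lambda>i x. s i x - t i x"]) simp_all
qed

text \<open>The zero function \<open>f - f\<close> has value \<open>y - z\<close>, whose norm is
  then at most 0. This makes the \<open>THE\<close> in \<open>bochner_integral\<close> well
  defined.\<close>

lemma has_bochner_value_unique:
  assumes "has_bochner_value M f y" "has_bochner_value M f z"
  shows "y = z"
  using norm_has_bochner_value_le[OF has_bochner_value_diff[OF assms]] by simp

text \<open>
  The approximating simple functions are cut off where their norm exceeds \<open>2 * norm (f x)\<close>, so that
  dominated convergence applies.
\<close>

lemma in_L1_imp_has_bochner_value:
  fixes f :: "'m \<Rightarrow> 'b::banach"
  assumes "in_L1 M f"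
  shows "has_bochner_value M f (bochner_integral M f)"
proof -
  have f: "strongly_measurable M f" and fin: "(\<integral>\<^sup>+x. ennreal (norm (f x)) \<partial>M) < \<infinity>"
    using assms by (auto simp: in_L1_def)
  obtain s where s: "\<And>i::nat. Bochner_Integration.simple_bochner_integrable M (s i)"
        and lim: "AE x in M. (\<lambda>i. s i x) \<longlonglongrightarrow> f x"
    using f unfolding strongly_measurable_def by metis
  note [measurable] = borel_measurable_norm_simple_bochner_integrable[OF s]
  obtain h where h[measurable]: "h \<in> borel_measurable M"
    and fh: "AE x in M. ennreal (norm (f x)) = h x"
    using strongly_measurable_norm_AE_eq[OF f] .
  \<comment> \<open>The threshold uses the measurable \<open>h\<close> in place of
    \<open>norm (f x)\<close>, so that the cut-off set is measurable and \<open>r i\<close> stays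
    simple.\<close>
  define r where "r i x = (if ennreal (norm (s i x)) \<le> 2 * h x then s i x else 0)" for i x
  have r: "Bochner_Integration.simple_bochner_integrable M (r i)" for i
  proof -
    define A where "A = {x \<in> space M. ennreal (norm (s i x)) \<le> 2 * h x}"
    have [measurable]: "A \<in> sets M" unfolding A_def by measurable
    have si: "simple_function M (s i)" "emeasure M {x \<in> space M. s i x \<noteq> 0} \<noteq> \<infinity>"
      using s[of i] by (auto elim: simple_bochner_integrable.cases)
    have "simple_function M (\<lambda>x. indicator A x *\<^sub>R s i x)"
      by (rule simple_function_compose2[where h="\<lambda>a. (*\<^sub>R) (a::real)"]) (auto intro: si)
    moreover have "r i x = indicator A x *\<^sub>R s i x" if "x \<in> space M" for x
      using that by (auto simp: r_def A_def)
    ultimately have "simple_function M (r i)"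
      by (subst simple_function_cong) auto
    moreover have "emeasure M {x \<in> space M. r i x \<noteq> 0} \<le> emeasure M {x \<in> space M. s i x \<noteq> 0}"
      using measurable_simple_function[OF si(1)]
      by (intro emeasure_mono) (auto simp: r_def)
    ultimately show ?thesis
      using si(2) by (intro simple_bochner_integrable.intros) (auto simp: top_unique)
  qed
  have "\<exists>k. k \<in> borel_measurable M \<and> (AE x in M. ennreal (norm (f x - r i x)) = k x)" for i
    using strongly_measurable_norm_AE_eq[OF strongly_measurable_diff[OF f
        simple_bochner_integrable_imp_strongly_measurable[OF r[of i]]]] by blast
  then obtain k where k[measurable]: "\<And>i. k i \<in> borel_measurable M"
    and fk: "\<And>i. AE x in M. ennreal (norm (f x - r i x)) = k i x"
    by metis
  \<comment> \<open>The majorant \<open>3 * h x\<close> comes from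
    \<open>norm (f x) + norm (r i x)\<close> with
    \<open>norm (r i x) \<le> 2 * norm (f x)\<close>.\<close>
  have "(\<lambda>i. \<integral>\<^sup>+x. k i x \<partial>M) \<longlonglongrightarrow> (\<integral>\<^sup>+x. 0 \<partial>M)"
  proof (rule nn_integral_dominated_convergence[where w="\<lambda>x. 3 * h x"])
    have "(\<integral>\<^sup>+x. h x \<partial>M) < \<infinity>"
      using fin nn_integral_cong_AE[OF fh] by simp
    then show "(\<integral>\<^sup>+x. 3 * h x \<partial>M) < \<infinity>"
      by (simp add: nn_integral_cmult ennreal_mult_less_top)
    show "AE x in M. k i x \<le> 3 * h x" for i
      using fh fk[of i]
    proof eventually_elim
      case (elim x)
      have "norm (r i x) \<le> 2 * norm (f x)"
        using elim(1)[symmetric] by (auto simp: r_def simp flip: ennreal_numeral ennreal_mult)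
      then have "norm (f x - r i x) \<le> 3 * norm (f x)"
        using norm_triangle_ineq4[of "f x" "r i x"] by linarith
      then have "ennreal (norm (f x - r i x)) \<le> ennreal (3 * norm (f x))"
        by (rule ennreal_leI)
      also have "\<dots> = 3 * ennreal (norm (f x))" by (simp add: ennreal_mult)
      finally show ?case using elim by simp
    qed
    have "AE x in M. \<forall>i. ennreal (norm (f x - r i x)) = k i x"
      using fk by (simp add: AE_all_countable)
    then show "AE x in M. (\<lambda>i. k i x) \<longlonglongrightarrow> 0"
      using fh lim
    proof eventually_elim
      case (elim x)
      \<comment> \<open>At a zero of \<open>f\<close> the threshold is 0 and forces
        \<open>r i x = 0\<close>; elsewhere \<open>norm (f x) < 2 * norm (f x)\<close>, so the
        cut-off is eventually inactive.\<close>
      have "(\<lambda>i. r i x) \<longlonglongrightarrow> f x"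
      proof (cases "f x = 0")
        case True
        then have "r i x = 0" for i
          using elim(2)[symmetric] by (auto simp: r_def)
        then show ?thesis using True by simp
      next
        case False
        have "\<forall>\<^sub>F i in sequentially. norm (s i x) < 2 * norm (f x)"
          using False by (intro order_tendstoD(2)[OF tendsto_norm[OF elim(3)]]) simp
        then have "\<forall>\<^sub>F i in sequentially. s i x = r i x"
        proof eventually_elim
          case (elim i)
          then have "ennreal (norm (s i x)) \<le> ennreal (2 * norm (f x))"
            by (intro ennreal_leI) simp
          then show ?case
            using \<open>ennreal (norm (f x)) = h x\<close> by (simp add: r_def ennreal_mult)
        qed
        then show ?thesis
          by (rule Lim_transform_eventually[OF elim(3)])
      qed
      then have "(\<lambda>i. ennreal (norm (f x - r i x))) \<longlonglongrightarrow> ennreal (norm (f x - f x))"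
        by (intro tendsto_ennrealI tendsto_intros)
      then show ?case using elim(1) by simp
    qed
  qed simp_all
  then have e: "(\<lambda>i. \<integral>\<^sup>+x. ennreal (norm (f x - r i x)) \<partial>M) \<longlonglongrightarrow> 0"
    using nn_integral_cong_AE[OF fk] by simp
  define a where "a i = Bochner_Integration.simple_bochner_integral M (r i)" for i
  note sm = simple_bochner_integrable_imp_strongly_measurable
  have a_diff: "ennreal (norm (a i - a j))
      \<le> (\<integral>\<^sup>+x. ennreal (norm (f x - r i x)) \<partial>M) + (\<integral>\<^sup>+x. ennreal (norm (f x - r j x)) \<partial>M)" for i j
  proof -
    have "a i - a j = Bochner_Integration.simple_bochner_integral M (\<lambda>x. r i x - r j x)"
      by (simp add: a_def simple_bochner_integral_diff r)
    then have "ennreal (norm (a i - a j)) \<le> (\<integral>\<^sup>+x. ennreal (norm (r i x - r j x)) \<partial>M)"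
      using norm_simple_bochner_integral_le[OF simple_bochner_integrable_diff[OF r r]] by simp
    also have "\<dots> \<le> (\<integral>\<^sup>+x. ennreal (norm (f x - r i x)) \<partial>M) + (\<integral>\<^sup>+x. ennreal (norm (f x - r j x)) \<partial>M)"
      by (rule nn_integral_norm_triangle_le[OF
            strongly_measurable_diff[OF f sm[OF r]] strongly_measurable_diff[OF f sm[OF r]]])
         (metis dual_order.refl norm_diff_triangle_le norm_minus_commute)
    finally show ?thesis .
  qed
  \<comment> \<open>Both \<open>r i\<close> and \<open>r j\<close> are close to \<open>f\<close> in
    mean, so their integrals form a Cauchy sequence; completeness of \<open>'b\<close> then supplies
    the value.\<close>
  have "Cauchy a"
  proof (rule metric_CauchyI)
    fix d :: real assume "d > 0"
    then have "\<forall>\<^sub>F i in sequentially. (\<integral>\<^sup>+x. ennreal (norm (f x - r i x)) \<partial>M) < ennreal (d/2)"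
      by (intro order_tendstoD(2)[OF e]) simp
    then obtain n where n: "\<And>i. i \<ge> n \<Longrightarrow> (\<integral>\<^sup>+x. ennreal (norm (f x - r i x)) \<partial>M) < ennreal (d/2)"
      by (auto simp: eventually_sequentially)
    have "dist (a i) (a j) < d" if "i \<ge> n" "j \<ge> n" for i j
    proof -
      have "ennreal (norm (a i - a j)) < ennreal (d/2) + ennreal (d/2)"
        by (rule le_less_trans[OF a_diff add_strict_mono[OF n[OF that(1)] n[OF that(2)]]])
      also have "\<dots> = ennreal d"
        using \<open>d > 0\<close> by (simp flip: ennreal_plus)
      finally show ?thesis by (simp add: dist_norm ennreal_less_iff)
    qed
    then show "\<exists>n. \<forall>i\<ge>n. \<forall>j\<ge>n. dist (a i) (a j) < d" by blast
  qed
  then obtain y where "a \<longlonglongrightarrow> y"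
    unfolding Cauchy_convergent_iff convergent_def by blast
  then have y: "has_bochner_value M f y"
    unfolding has_bochner_value_def a_def using f r e by blast
  have "bochner_integral M f = y"
    unfolding bochner_integral_def
    by (rule the_equality) (fact y, rule has_bochner_value_unique[OF _ y])
  with y show ?thesis by simp
qed
section \<open>Convolution of an operator kernel with a continuous function\<close>

lemma lebesgue_reflect:
  fixes t :: real
  shows "(\<lambda>x. t - x) \<in> lebesgue \<rightarrow>\<^sub>M lebesgue" "distr lebesgue lebesgue (\<lambda>x. t - x) = lebesgue"
proof -
  show "(\<lambda>x. t - x) \<in> lebesgue \<rightarrow>\<^sub>M lebesgue"
    using lebesgue_affine_measurable[of "\<lambda>_. -1" t] by simp
  show "distr lebesgue lebesgue (\<lambda>x. t - x) = lebesgue"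
    using lebesgue_real_affine[of "-1" t] by (simp add: density_1)
qed

lemma AE_lebesgue_reflect:
  fixes t :: real
  assumes "AE x in lebesgue. Q x"
  shows "AE x in lebesgue. Q (t - x)"
  using AE_distrD[OF lebesgue_reflect(1), of Q t] assms unfolding lebesgue_reflect(2) .

lemma nn_integral_lebesgue_reflect:
  fixes t :: real
  assumes "k \<in> borel_measurable lebesgue"
  shows "(\<integral>\<^sup>+x. k (t - x) \<partial>lebesgue) = (\<integral>\<^sup>+x. k x \<partial>lebesgue)"
  using nn_integral_real_affine_lebesgue[OF assms, of "-1" t] by simp

text \<open>Enlarging \<open>(0,t)\<close> to the whole line can only increase the integral of the
  nonnegative bound, and reflection preserves Lebesgue measure. Convolution integrals are thereby
  bounded by the mass of a kernel on the line.\<close>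

lemma nn_integral_lebesgue_on_reflect_le:
  fixes f k :: "real \<Rightarrow> ennreal"
  assumes k: "k \<in> borel_measurable lebesgue"
    and le: "AE s in lebesgue. s \<in> {0<..<t} \<longrightarrow> f s \<le> k (t - s)"
  shows "(\<integral>\<^sup>+s. f s \<partial>lebesgue_on {0<..<t}) \<le> (\<integral>\<^sup>+s. k s \<partial>lebesgue)"
proof -
  have "(\<integral>\<^sup>+s. f s \<partial>lebesgue_on {0<..<t}) = (\<integral>\<^sup>+s. f s * indicator {0<..<t} s \<partial>lebesgue)"
    by (rule nn_integral_restrict_space) simp
  also have "\<dots> \<le> (\<integral>\<^sup>+s. k (t - s) \<partial>lebesgue)"
    using le by (intro nn_integral_mono_AE) (auto elim!: eventually_mono simp: indicator_def)
  also have "\<dots> = (\<integral>\<^sup>+s. k s \<partial>lebesgue)"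
    by (rule nn_integral_lebesgue_reflect[OF k])
  finally show ?thesis .
qed

text \<open>The interval has finite measure, being empty for \<open>t < 0\<close>, so the support
  condition holds automatically.\<close>

lemma simple_bochner_integrable_lebesgue_on_iff:
  fixes s :: "real \<Rightarrow> 'b::real_vector"
  shows "Bochner_Integration.simple_bochner_integrable (lebesgue_on {0<..<t}) s
    \<longleftrightarrow> simple_function (lebesgue_on {0<..<t}) s"
proof -
  have "emeasure (lebesgue_on {0<..<t}) A \<noteq> \<infinity>" for A
  proof -
    have "emeasure (lebesgue_on {0<..<t}) A \<le> emeasure (lebesgue_on {0<..<t}) (space (lebesgue_on {0<..<t}))"
      by (rule emeasure_space)
    also have "\<dots> < \<infinity>"
      by (cases "0 \<le> t") (simp_all add: emeasure_restrict_space)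
    finally show ?thesis by simp
  qed
  then show ?thesis by (auto simp: simple_bochner_integrable.simps)
qed

section \<open>The convolution integrand and its scalar kernel\<close>

lemma AE_lebesgue_on_Ioo_iff:
  fixes t :: real
  shows "(AE x in lebesgue_on {0<..<t}. Q x) \<longleftrightarrow> (AE x in lebesgue. x \<in> {0<..<t} \<longrightarrow> Q x)"
  by (rule AE_restrict_space_iff) simp

text \<open>Rounding down to the grid of mesh \<open>1 / Suc i\<close> moves \<open>x\<close> by at
  most one mesh width. The grid points are where continuous functions get sampled to form step
  functions.\<close>

lemma tendsto_floor_mult_divide:
  fixes x :: real
  shows "(\<lambda>i. of_int \<lfloor>real (Suc i) * x\<rfloor> / real (Suc i)) \<longlonglongrightarrow> x"
proof (rule tendsto_sandwich[OF _ _ _ tendsto_const])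
  have "(\<lambda>i. x - inverse (real (Suc i))) \<longlonglongrightarrow> x - 0"
    by (intro tendsto_diff tendsto_const LIMSEQ_inverse_real_of_nat)
  then show "(\<lambda>i. x - inverse (real (Suc i))) \<longlonglongrightarrow> x" by simp
  show "\<forall>\<^sub>F i in sequentially. x - inverse (real (Suc i)) \<le> of_int \<lfloor>real (Suc i) * x\<rfloor> / real (Suc i)"
  proof (rule always_eventually, rule allI)
    fix i
    have "x - inverse (real (Suc i)) = (real (Suc i) * x - 1) / real (Suc i)"
      by (simp add: field_simps)
    also have "\<dots> \<le> of_int \<lfloor>real (Suc i) * x\<rfloor> / real (Suc i)"
      by (intro divide_right_mono) linarith+
    finally show "x - inverse (real (Suc i)) \<le> of_int \<lfloor>real (Suc i) * x\<rfloor> / real (Suc i)" .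
  qed
  show "\<forall>\<^sub>F i in sequentially. of_int \<lfloor>real (Suc i) * x\<rfloor> / real (Suc i) \<le> x"
    by (rule always_eventually) (auto simp: divide_le_eq mult.commute simp del: of_nat_Suc)
qed

text \<open>Operator application is jointly continuous, so simple approximations of
  \<open>P (t - s)\<close> applied to sampled values of \<open>w\<close> converge wherever the
  former do.\<close>

lemma strongly_measurable_convolution_integrand:
  fixes P :: "real \<Rightarrow> 'a::real_normed_vector \<Rightarrow>\<^sub>L 'b::real_normed_vector" and w :: "real \<Rightarrow> 'a"
  assumes P: "strongly_measurable (lebesgue_on {0<..<T}) P"
    and w: "continuous_on {0..T} w" and t: "t \<le> T"
  shows "strongly_measurable (lebesgue_on {0<..<t}) (\<lambda>s. blinfun_apply (P (t - s)) (w s))"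
proof -
  obtain p where p: "\<And>i::nat. Bochner_Integration.simple_bochner_integrable (lebesgue_on {0<..<T}) (p i)"
    and lim: "AE x in lebesgue_on {0<..<T}. (\<lambda>i. p i x) \<longlonglongrightarrow> P x"
    using P unfolding strongly_measurable_def by blast
  \<comment> \<open>Rounding down keeps \<open>q i x\<close> in \<open>[0,T]\<close>, where
    \<open>w\<close> is continuous.\<close>
  define q where "q i x = (of_int \<lfloor>real (Suc i) * x\<rfloor> / real (Suc i) :: real)" for i x
  have q_simple: "simple_function (lebesgue_on {0<..<t}) (q i)" for i
  proof (rule simple_function_borel_measurable)
    have "q i \<in> borel_measurable borel"
      unfolding q_def[abs_def] by measurable
    then show "q i \<in> borel_measurable (lebesgue_on {0<..<t})"
      by (intro measurable_restrict_space1 measurable_completion) simp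
    \<comment> \<open>Only finitely many grid points occur: the numerators lie between 0 and the
      ceiling of \<open>Suc i * t\<close>.\<close>
    have "q i ` {0<..<t} \<subseteq> (\<lambda>n. of_int n / real (Suc i)) ` {0..\<lceil>real (Suc i) * t\<rceil>}"
    proof
      fix y assume "y \<in> q i ` {0<..<t}"
      then obtain x where x: "0 < x" "x < t" "y = q i x" by auto
      then have "real (Suc i) * x \<le> real (Suc i) * t"
        by (intro mult_left_mono) auto
      then have "\<lfloor>real (Suc i) * x\<rfloor> \<le> \<lceil>real (Suc i) * t\<rceil>" by linarith
      moreover have "0 \<le> \<lfloor>real (Suc i) * x\<rfloor>" using x by simp
      ultimately show "y \<in> (\<lambda>n. of_int n / real (Suc i)) ` {0..\<lceil>real (Suc i) * t\<rceil>}"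
        using x(3) by (auto simp: q_def)
    qed
    then have "finite (q i ` {0<..<t})"
      by (rule finite_subset) simp
    then show "finite (q i ` space (lebesgue_on {0<..<t}))"
      by simp
  qed
  \<comment> \<open>Since \<open>t \<le> T\<close>, the reflection maps \<open>(0,t)\<close> into
    the interval on which \<open>p i\<close> is simple.\<close>
  have refl: "(\<lambda>x. t - x) \<in> lebesgue_on {0<..<t} \<rightarrow>\<^sub>M lebesgue_on {0<..<T}"
    using t by (intro measurable_restrict_space3 lebesgue_reflect) auto
  define r where "r i x = blinfun_apply (p i (t - x)) (w (q i x))" for i x
  have "simple_function (lebesgue_on {0<..<t}) (r i)" for i
    unfolding r_def
  proof (rule simple_function_compose2[where h=blinfun_apply])
    show "simple_function (lebesgue_on {0<..<t}) (\<lambda>x. p i (t - x))"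
      using p[of i] by (intro simple_function_comp[OF refl]) (simp add: simple_bochner_integrable_lebesgue_on_iff)
    show "simple_function (lebesgue_on {0<..<t}) (\<lambda>x. w (q i x))"
      by (rule simple_function_compose1[OF q_simple])
  qed
  moreover have "AE x in lebesgue_on {0<..<t}. (\<lambda>i. r i x) \<longlonglongrightarrow> blinfun_apply (P (t - x)) (w x)"
    unfolding AE_lebesgue_on_Ioo_iff
    using AE_lebesgue_reflect[OF lim[unfolded AE_lebesgue_on_Ioo_iff], of t]
  proof (eventually_elim, intro impI)
    fix x assume elim: "t - x \<in> {0<..<T} \<longrightarrow> (\<lambda>i. p i (t - x)) \<longlonglongrightarrow> P (t - x)" "x \<in> {0<..<t}"
    have "q i x \<in> {0..T}" for i
    proof -
      have "0 \<le> q i x" using elim(2) by (simp add: q_def)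
      moreover have "q i x \<le> x"
        by (auto simp: q_def divide_le_eq mult.commute simp del: of_nat_Suc)
      ultimately show ?thesis using elim(2) t by auto
    qed
    moreover have "(\<lambda>i. q i x) \<longlonglongrightarrow> x"
      unfolding q_def by (rule tendsto_floor_mult_divide)
    ultimately have "(\<lambda>i. w (q i x)) \<longlonglongrightarrow> w x"
      using elim(2) t by (intro continuous_on_tendsto_compose[OF w]) auto
    moreover have "(\<lambda>i. p i (t - x)) \<longlonglongrightarrow> P (t - x)"
      using elim t by auto
    ultimately show "(\<lambda>i. r i x) \<longlonglongrightarrow> blinfun_apply (P (t - x)) (w x)"
      unfolding r_def by (rule bounded_bilinear.tendsto[OF bounded_bilinear_blinfun_apply, rotated])
  qed
  ultimately show ?thesis
    unfolding strongly_measurable_def simple_bochner_integrable_lebesgue_on_iff by blast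
qed

text \<open>Extending a measurable version of the norm of \<open>P\<close> by zero gives a scalar
  kernel on the whole line, to which reflection and exponential weights apply.\<close>

lemma in_L1_lebesgue_on_norm_AE_eq:
  fixes P :: "real \<Rightarrow> 'b::real_normed_vector"
  assumes "in_L1 (lebesgue_on {0<..<T}) P"
  obtains k where "k \<in> borel_measurable lebesgue"
    "AE x in lebesgue. x \<in> {0<..<T} \<longrightarrow> ennreal (norm (P x)) = k x"
    "(\<integral>\<^sup>+x. k x \<partial>lebesgue) < \<infinity>" "\<And>x. x \<notin> {0<..<T} \<Longrightarrow> k x = 0"
proof -
  obtain h where h: "h \<in> borel_measurable (lebesgue_on {0<..<T})"
    and Ph: "AE x in lebesgue_on {0<..<T}. ennreal (norm (P x)) = h x"
    using strongly_measurable_norm_AE_eq assms unfolding in_L1_def by blast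
  define k where "k x = h x * indicator {0<..<T} x" for x
  show ?thesis
  proof
    show "k \<in> borel_measurable lebesgue"
      using h unfolding k_def[abs_def]
      by (subst (asm) borel_measurable_restrict_space_iff_ennreal) auto
    show "AE x in lebesgue. x \<in> {0<..<T} \<longrightarrow> ennreal (norm (P x)) = k x"
      using Ph unfolding AE_lebesgue_on_Ioo_iff by eventually_elim (simp add: k_def)
    have "(\<integral>\<^sup>+x. k x \<partial>lebesgue) = (\<integral>\<^sup>+x. h x \<partial>lebesgue_on {0<..<T})"
      unfolding k_def by (rule nn_integral_restrict_space[symmetric]) simp
    also have "\<dots> = (\<integral>\<^sup>+x. ennreal (norm (P x)) \<partial>lebesgue_on {0<..<T})"
      using nn_integral_cong_AE[OF Ph] by simp
    finally show "(\<integral>\<^sup>+x. k x \<partial>lebesgue) < \<infinity>"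
      using assms by (simp add: in_L1_def)
    show "k x = 0" if "x \<notin> {0<..<T}" for x
      using that by (simp add: k_def)
  qed
qed

text \<open>For \<open>x > 0\<close> the weights are at most 1 and tend to 0, and \<open>k\<close>
  vanishes elsewhere, so dominated convergence applies with \<open>k\<close> itself as
  majorant.\<close>

lemma nn_integral_exp_weight_small:
  fixes k :: "real \<Rightarrow> ennreal"
  assumes k[measurable]: "k \<in> borel_measurable lebesgue"
    and fin: "(\<integral>\<^sup>+x. k x \<partial>lebesgue) < \<infinity>" and supp: "\<And>x. x \<le> 0 \<Longrightarrow> k x = 0"
    and "e > 0"
  obtains n :: nat where "(\<integral>\<^sup>+x. k x * ennreal (exp (- (real n * x))) \<partial>lebesgue) < e"
proof -
  have [measurable]: "(\<lambda>x. exp (- (real n * x))) \<in> borel_measurable lebesgue" for n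
    by (intro measurable_completion) measurable
  have "(\<lambda>n. \<integral>\<^sup>+x. k x * ennreal (exp (- (real n * x))) \<partial>lebesgue) \<longlonglongrightarrow> (\<integral>\<^sup>+x. 0 \<partial>(lebesgue :: real measure))"
  proof (rule nn_integral_dominated_convergence[where w=k])
    show "AE x in lebesgue. k x * ennreal (exp (- (real n * x))) \<le> k x" for n
    proof (rule AE_I2)
      fix x
      show "k x * ennreal (exp (- (real n * x))) \<le> k x"
      proof (cases "x \<le> 0")
        case False
        then have "ennreal (exp (- (real n * x))) \<le> 1" by simp
        then show ?thesis using mult_left_mono[of _ 1 "k x"] by fastforce
      qed (simp add: supp)
    qed
    \<comment> \<open>Where \<open>k x\<close> is infinite, its product with a positive weight stays
      infinite; the pointwise limit 0 therefore rests on finiteness a.e.\<close>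
    have "AE x in lebesgue. k x \<noteq> \<infinity>"
      using fin by (intro nn_integral_noteq_infinite) auto
    then show "AE x in lebesgue. (\<lambda>n. k x * ennreal (exp (- (real n * x)))) \<longlonglongrightarrow> 0"
    proof eventually_elim
      case (elim x)
      show ?case
      proof (cases "x \<le> 0")
        case False
        have "(\<lambda>n. exp (- x) ^ n) \<longlonglongrightarrow> 0"
          using False by (intro LIMSEQ_realpow_zero) auto
        then have "(\<lambda>n. exp (- (real n * x))) \<longlonglongrightarrow> 0"
          by (simp flip: exp_of_nat_mult)
        then have "(\<lambda>n. k x * ennreal (exp (- (real n * x)))) \<longlonglongrightarrow> k x * ennreal 0"
          using elim by (intro ennreal_tendsto_cmult tendsto_ennrealI) (simp_all add: less_top)
        then show ?thesis by simp
      qed (simp add: supp)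
    qed
  qed (use fin in simp_all)
  then have "\<forall>\<^sub>F n in sequentially. (\<integral>\<^sup>+x. k x * ennreal (exp (- (real n * x))) \<partial>lebesgue) < e"
    using \<open>e > 0\<close> by (intro order_tendstoD(2)) simp_all
  then show ?thesis
    using that by (auto simp: eventually_sequentially)
qed

text \<open>On the compact interval \<open>w\<close> is bounded by some \<open>B\<close>, so the
  integrand is dominated by \<open>B\<close> times the reflected norm of \<open>P\<close>.\<close>

lemma in_L1_convolution_integrand:
  fixes P :: "real \<Rightarrow> 'a::real_normed_vector \<Rightarrow>\<^sub>L 'b::real_normed_vector" and w :: "real \<Rightarrow> 'a"
  assumes P: "in_L1 (lebesgue_on {0<..<T}) P"
    and w: "continuous_on {0..T} w" and t: "t \<le> T"
  shows "in_L1 (lebesgue_on {0<..<t}) (\<lambda>s. blinfun_apply (P (t - s)) (w s))"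
proof -
  obtain k where k[measurable]: "k \<in> borel_measurable lebesgue"
    and Pk: "AE x in lebesgue. x \<in> {0<..<T} \<longrightarrow> ennreal (norm (P x)) = k x"
    and fin: "(\<integral>\<^sup>+x. k x \<partial>lebesgue) < \<infinity>"
    using in_L1_lebesgue_on_norm_AE_eq[OF P] by blast
  have "bounded (w ` {0..T})"
    by (intro compact_imp_bounded compact_continuous_image w) simp
  then obtain B where B: "\<And>s. s \<in> {0..T} \<Longrightarrow> norm (w s) \<le> B"
    unfolding bounded_iff by blast
  have "(\<integral>\<^sup>+s. ennreal (norm (blinfun_apply (P (t - s)) (w s))) \<partial>lebesgue_on {0<..<t})
      \<le> (\<integral>\<^sup>+s. k s * ennreal B \<partial>lebesgue)"
  proof (rule nn_integral_lebesgue_on_reflect_le)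
    show "AE s in lebesgue. s \<in> {0<..<t} \<longrightarrow>
        ennreal (norm (blinfun_apply (P (t - s)) (w s))) \<le> k (t - s) * ennreal B"
      using AE_lebesgue_reflect[OF Pk, of t]
    proof (eventually_elim, intro impI)
      fix s assume elim: "t - s \<in> {0<..<T} \<longrightarrow> ennreal (norm (P (t - s))) = k (t - s)" "s \<in> {0<..<t}"
      have "norm (blinfun_apply (P (t - s)) (w s)) \<le> norm (P (t - s)) * B"
        using elim(2) t by (intro order_trans[OF norm_blinfun mult_left_mono[OF B]]) auto
      then have "ennreal (norm (blinfun_apply (P (t - s)) (w s))) \<le> ennreal (norm (P (t - s)) * B)"
        by (rule ennreal_leI)
      also have "\<dots> = k (t - s) * ennreal B"
        using elim t by (simp add: ennreal_mult')
      finally show "ennreal (norm (blinfun_apply (P (t - s)) (w s))) \<le> k (t - s) * ennreal B" .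
    qed
  qed simp
  also have "\<dots> < \<infinity>"
    using fin by (simp add: nn_integral_multc ennreal_mult_less_top)
  finally show ?thesis
    using P by (auto simp: in_L1_def intro: strongly_measurable_convolution_integrand[OF _ w t])
qed

section \<open>Difference of mild solutions\<close>

text \<open>Once linearity removes the \<open>S\<close> term, the difference of the two equations is
  a Bochner value of the difference of the integrands, to which the norm bound applies.
  Integrability of both integrands ensures that each \<open>bochner_integral\<close> is an actual
  value.\<close>

lemma mild_solution_diff_le:
  assumes u: "mild_solution S P N T u0 u" and v: "mild_solution S P N T v0 v"
    and P: "in_L1 (lebesgue_on {0<..<T}) P"
    and Nu: "continuous_on {0..T} (\<lambda>s. N (u s))" and Nv: "continuous_on {0..T} (\<lambda>s. N (v s))"
    and t: "t \<in> {0..T}"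
  shows "ennreal (norm (u t - v t - blinfun_apply (S t) (u0 - v0)))
    \<le> (\<integral>\<^sup>+s. ennreal (norm (blinfun_apply (P (t - s)) (N (u s) - N (v s)))) \<partial>lebesgue_on {0<..<t})"
proof -
  define I where "I w = bochner_integral (lebesgue_on {0<..<t}) (\<lambda>s. blinfun_apply (P (t - s)) (N (w s)))" for w
  have "has_bochner_value (lebesgue_on {0<..<t})
      (\<lambda>s. blinfun_apply (P (t - s)) (N (u s)) - blinfun_apply (P (t - s)) (N (v s))) (I u - I v)"
    unfolding I_def using t
    by (intro has_bochner_value_diff in_L1_imp_has_bochner_value
        in_L1_convolution_integrand[OF P Nu] in_L1_convolution_integrand[OF P Nv]) auto
  moreover have "u t - v t - blinfun_apply (S t) (u0 - v0) = I u - I v"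
    using u v t by (simp add: mild_solution_def I_def blinfun.diff_right)
  ultimately show ?thesis
    using norm_has_bochner_value_le by (fastforce simp: blinfun.diff_right)
qed

section \<open>The supremum norm and a weighted Gronwall inequality\<close>

lemma norm_le_C_norm:
  assumes "continuous_on {0..T} u" "t \<in> {0..T}"
  shows "norm (u t) \<le> C_norm T u"
  unfolding C_norm_def
proof (rule cSUP_upper[OF assms(2)])
  have "compact ((\<lambda>t. norm (u t)) ` {0..T})"
    by (intro compact_continuous_image continuous_on_norm assms) simp
  then show "bdd_above ((\<lambda>t. norm (u t)) ` {0..T})"
    by (intro bounded_imp_bdd_above compact_imp_bounded)
qed

lemma C_norm_le:
  assumes "0 \<le> T" "\<And>t. t \<in> {0..T} \<Longrightarrow> norm (u t) \<le> c"
  shows "C_norm T u \<le> c"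
  unfolding C_norm_def using assms by (intro cSUP_least) auto

text \<open>
  The integral term is absorbed at a maximum point of \<open>exp (- n t) * d t\<close>.
\<close>

lemma gronwall_weighted:
  fixes d :: "real \<Rightarrow> real" and k :: "real \<Rightarrow> ennreal"
  assumes k[measurable]: "k \<in> borel_measurable lebesgue"
    and d: "continuous_on {0..T} d" "\<And>t. t \<in> {0..T} \<Longrightarrow> 0 \<le> d t" and "0 \<le> T" "0 \<le> L"
    and small: "ennreal L * (\<integral>\<^sup>+x. k x * ennreal (exp (- (real n * x))) \<partial>lebesgue) \<le> ennreal (1/2)"
    and le: "\<And>t. t \<in> {0..T} \<Longrightarrow> ennreal (d t - a) \<le>
      (\<integral>\<^sup>+s. k (t - s) * ennreal (L * d s) \<partial>lebesgue_on {0<..<t})" and "0 \<le> a"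
    and t: "t \<in> {0..T}"
  shows "d t \<le> 2 * exp (real n * T) * a"
proof -
  have [measurable]: "(\<lambda>x. exp (- (real n * x))) \<in> borel_measurable lebesgue"
    by (intro measurable_completion) measurable
  define e where "e s = exp (- (real n * s)) * d s" for s
  have "\<exists>m\<in>{0..T}. \<forall>s\<in>{0..T}. e s \<le> e m"
    unfolding e_def[abs_def] using \<open>0 \<le> T\<close> by (intro continuous_attains_sup continuous_intros d) auto
  then obtain m where m: "m \<in> {0..T}" and max: "\<And>s. s \<in> {0..T} \<Longrightarrow> e s \<le> e m" by blast
  have em: "0 \<le> e m" using d(2)[OF m] by (simp add: e_def)
  have dm: "d m = exp (real n * m) * e m"
    by (simp add: e_def flip: exp_add mult.assoc)
  have "ennreal (d m - a) \<le> (\<integral>\<^sup>+s. k (m - s) * ennreal (L * d s) \<partial>lebesgue_on {0<..<m})"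
    by (rule le[OF m])
  \<comment> \<open>Maximality \<open>e s \<le> e m\<close> reads
    \<open>d s \<le> d m * exp (- (n * (m - s)))\<close>: the weight lands on the argument
    \<open>m - s\<close> of the kernel.\<close>
  also have "\<dots> \<le> (\<integral>\<^sup>+x. ennreal (L * d m) * (k x * ennreal (exp (- (real n * x)))) \<partial>lebesgue)"
  proof (rule nn_integral_lebesgue_on_reflect_le, measurable, rule AE_I2, rule impI)
    fix s assume s: "s \<in> {0<..<m}"
    have "d s = exp (real n * s) * e s"
      by (simp add: e_def flip: exp_add mult.assoc)
    also have "\<dots> \<le> exp (real n * s) * e m"
      using s m by (intro mult_left_mono max) auto
    also have "\<dots> = d m * exp (- (real n * (m - s)))"
      by (simp add: dm algebra_simps flip: exp_add mult.assoc)
    finally have "L * d s \<le> L * d m * exp (- (real n * (m - s)))"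
      using \<open>0 \<le> L\<close> by (simp add: mult_left_mono mult.assoc)
    then have "ennreal (L * d s) \<le> ennreal (L * d m * exp (- (real n * (m - s))))"
      by (rule ennreal_leI)
    also have "\<dots> = ennreal (L * d m) * ennreal (exp (- (real n * (m - s))))"
      by (simp add: ennreal_mult'')
    finally show "k (m - s) * ennreal (L * d s)
        \<le> ennreal (L * d m) * (k (m - s) * ennreal (exp (- (real n * (m - s)))))"
      by (subst mult.left_commute) (rule mult_left_mono, simp_all)
  qed
  also have "\<dots> = ennreal (d m) * (ennreal L * (\<integral>\<^sup>+x. k x * ennreal (exp (- (real n * x))) \<partial>lebesgue))"
    using \<open>0 \<le> L\<close> d(2)[OF m]
    by (subst nn_integral_cmult, measurable) (simp add: ennreal_mult mult_ac)
  also have "\<dots> \<le> ennreal (d m) * ennreal (1/2)"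
    by (intro mult_left_mono small) simp
  also have "\<dots> = ennreal (d m / 2)"
    by (subst ennreal_mult''[symmetric]) simp_all
  \<comment> \<open>\<open>ennreal\<close> truncates a negative \<open>d m - a\<close> to 0, which
    is harmless because \<open>d m / 2\<close> is nonnegative.\<close>
  finally have "d m - a \<le> d m / 2"
    using d(2)[OF m] by (simp add: ennreal_le_iff)
  then have "d m \<le> 2 * a" by simp
  \<comment> \<open>Back from the maximum point to \<open>t\<close>: undoing the weight costs at
    most \<open>exp (n * T)\<close>, and \<open>e m \<le> d m\<close> since \<open>m\<close> is
    nonnegative.\<close>
  have "d t = exp (real n * t) * e t"
    by (simp add: e_def flip: exp_add mult.assoc)
  also have "\<dots> \<le> exp (real n * T) * e m"
    using t em d(2)[OF t] by (intro mult_mono max) (auto simp: mult_left_mono e_def)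
  also have "e m \<le> d m"
    using m d(2)[OF m] by (simp add: e_def mult_left_le_one_le)
  also note \<open>d m \<le> 2 * a\<close>
  finally show ?thesis by (simp add: mult_ac)
qed

section \<open>Lipschitz dependence on the initial value\<close>

theorem proposition3p2:
  fixes S P :: "real \<Rightarrow> 'a::banach \<Rightarrow>\<^sub>L 'a"
    and N :: "'a \<Rightarrow> 'a"
  assumes "strongly_continuous S"
    and "locally_bounded_family S"
    and "S 0 = id_blinfun"
    and "\<And>T. T > 0 \<Longrightarrow> in_L1 (lebesgue_on {0<..<T}) P"
    and "lipschitz_on_bounded_sets N"
  shows "\<forall>R>0. \<forall>T>0. \<exists>C. \<forall>u0 v0 u v.
           mild_solution S P N T u0 u \<longrightarrow>
           mild_solution S P N T v0 v \<longrightarrow>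
           C_norm T u + C_norm T v \<le> R \<longrightarrow>
           C_norm T (\<lambda>t. u t - v t) \<le> C * norm (u0 - v0)"
proof (intro allI impI)
  fix R T :: real assume "R > 0" "T > 0"
  \<comment> \<open>Passing to \<open>max L 1\<close> makes the constant positive, as required for
    the threshold \<open>1 / (2 * L)\<close> below.\<close>
  obtain L where L: "L > 0"
    and lip: "\<And>x y. norm x \<le> R \<Longrightarrow> norm y \<le> R \<Longrightarrow> norm (N x - N y) \<le> L * norm (x - y)"
  proof -
    obtain L where lip: "\<And>x y. norm x \<le> R \<Longrightarrow> norm y \<le> R \<Longrightarrow> norm (N x - N y) \<le> L * norm (x - y)"
      using assms(5) \<open>R > 0\<close> unfolding lipschitz_on_bounded_sets_def by blast
    have "L * norm (x - y) \<le> max L 1 * norm (x - y)" for x y :: 'a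
      by (intro mult_right_mono) auto
    then show ?thesis
      using that[of "max L 1"] lip by (meson less_max_iff_disj order_trans zero_less_one)
  qed
  \<comment> \<open>Continuity of \<open>N\<close> on the ball makes its composition with each
    solution continuous, so that the convolution integrals exist.\<close>
  have N: "continuous_on (cball 0 R) N"
    using L by (intro lipschitz_on_continuous_on[of L] lipschitz_onI) (auto simp: dist_norm intro: lip)
  obtain M where M: "\<And>t. t \<in> {0..T} \<Longrightarrow> norm (S t) \<le> M"
    using assms(2) \<open>T > 0\<close> unfolding locally_bounded_family_def bounded_iff by blast
  have "0 \<le> M" using M[of 0] \<open>T > 0\<close> by (auto intro: order_trans[OF norm_ge_zero])
  have P: "in_L1 (lebesgue_on {0<..<T}) P" by (rule assms(4)[OF \<open>T > 0\<close>])
  obtain k where k[measurable]: "k \<in> borel_measurable lebesgue"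
    and Pk: "AE x in lebesgue. x \<in> {0<..<T} \<longrightarrow> ennreal (norm (P x)) = k x"
    and fin: "(\<integral>\<^sup>+x. k x \<partial>lebesgue) < \<infinity>" and supp: "\<And>x. x \<notin> {0<..<T} \<Longrightarrow> k x = 0"
    using in_L1_lebesgue_on_norm_AE_eq[OF P] by blast
  \<comment> \<open>The threshold gives mass at most 1/2 after multiplication by \<open>L\<close>.
    The choice of \<open>n\<close> depends on \<open>k\<close> and \<open>L\<close> only, hence not
    on the solutions.\<close>
  obtain n where n: "(\<integral>\<^sup>+x. k x * ennreal (exp (- (real n * x))) \<partial>lebesgue) < ennreal (1 / (2 * L))"
    using nn_integral_exp_weight_small[OF k fin, of "ennreal (1 / (2 * L))"] supp L by auto
  have small: "ennreal L * (\<integral>\<^sup>+x. k x * ennreal (exp (- (real n * x))) \<partial>lebesgue) \<le> ennreal (1/2)"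
  proof -
    have "ennreal L * (\<integral>\<^sup>+x. k x * ennreal (exp (- (real n * x))) \<partial>lebesgue)
        \<le> ennreal L * ennreal (1 / (2 * L))"
      using n by (intro mult_left_mono) auto
    also have "\<dots> = ennreal (1/2)" using L by (simp flip: ennreal_mult)
    finally show ?thesis .
  qed
  \<comment> \<open>The factor 2 comes from absorbing half of the maximum, the exponential from
    removing the weight, and \<open>M\<close> from the bound on \<open>S\<close>.\<close>
  define C where "C = 2 * exp (real n * T) * M"
  have "C_norm T (\<lambda>t. u t - v t) \<le> C * norm (u0 - v0)"
    if u: "mild_solution S P N T u0 u" and v: "mild_solution S P N T v0 v"
      and R: "C_norm T u + C_norm T v \<le> R" for u0 v0 u v
  proof (rule C_norm_le)
    fix t assume t: "t \<in> {0..T}"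
    have cu: "continuous_on {0..T} u" and cv: "continuous_on {0..T} v"
      using u v by (auto simp: mild_solution_def)
    \<comment> \<open>Each norm is at most the sum of both, so the solutions stay in the ball where
      \<open>lip\<close> holds.\<close>
    have uR: "norm (u s) \<le> R" and vR: "norm (v s) \<le> R" if "s \<in> {0..T}" for s
      using norm_le_C_norm[OF cu that] norm_le_C_norm[OF cv that] R
        norm_ge_zero[of "u s"] norm_ge_zero[of "v s"] by linarith+
    have Nu: "continuous_on {0..T} (\<lambda>s. N (u s))"
      using uR by (intro continuous_on_compose2[OF N cu]) auto
    have Nv: "continuous_on {0..T} (\<lambda>s. N (v s))"
      using vR by (intro continuous_on_compose2[OF N cv]) auto
    have "norm (u t - v t) \<le> 2 * exp (real n * T) * (M * norm (u0 - v0))"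
    proof (rule gronwall_weighted[where k=k and L=L and d="\<lambda>t. norm (u t - v t)"])
      fix t assume t: "t \<in> {0..T}"
      \<comment> \<open>The reverse triangle inequality separates the contribution of the initial
        values, at most \<open>M * norm (u0 - v0)\<close>, from the integral term.\<close>
      have "norm (blinfun_apply (S t) (u0 - v0)) \<le> M * norm (u0 - v0)"
        by (rule order_trans[OF norm_blinfun]) (intro mult_right_mono M t norm_ge_zero)
      then have "norm (u t - v t) - M * norm (u0 - v0) \<le> norm (u t - v t - blinfun_apply (S t) (u0 - v0))"
        using norm_triangle_ineq2[of "u t - v t" "blinfun_apply (S t) (u0 - v0)"] by linarith
      then have "ennreal (norm (u t - v t) - M * norm (u0 - v0))
          \<le> ennreal (norm (u t - v t - blinfun_apply (S t) (u0 - v0)))"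
        by (rule ennreal_leI)
      also have "\<dots> \<le> (\<integral>\<^sup>+s. ennreal (norm (blinfun_apply (P (t - s)) (N (u s) - N (v s)))) \<partial>lebesgue_on {0<..<t})"
        by (rule mild_solution_diff_le[OF u v P Nu Nv t])
      \<comment> \<open>The Lipschitz bound enters here, and \<open>norm (P (t - s))\<close> becomes
        \<open>k (t - s)\<close>, valid for a.e. \<open>s\<close> because reflection preserves null
        sets.\<close>
      also have "\<dots> \<le> (\<integral>\<^sup>+s. k (t - s) * ennreal (L * norm (u s - v s)) \<partial>lebesgue_on {0<..<t})"
      proof (rule nn_integral_mono_AE, unfold AE_lebesgue_on_Ioo_iff)
        show "AE s in lebesgue. s \<in> {0<..<t} \<longrightarrow> ennreal (norm (blinfun_apply (P (t - s)) (N (u s) - N (v s))))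
            \<le> k (t - s) * ennreal (L * norm (u s - v s))"
          using AE_lebesgue_reflect[OF Pk, of t]
        proof (eventually_elim, intro impI)
          fix s assume elim: "t - s \<in> {0<..<T} \<longrightarrow> ennreal (norm (P (t - s))) = k (t - s)" "s \<in> {0<..<t}"
          have "norm (blinfun_apply (P (t - s)) (N (u s) - N (v s)))
              \<le> norm (P (t - s)) * (L * norm (u s - v s))"
            using elim(2) t by (intro order_trans[OF norm_blinfun] mult_left_mono lip uR vR) auto
          then have "ennreal (norm (blinfun_apply (P (t - s)) (N (u s) - N (v s))))
              \<le> ennreal (norm (P (t - s)) * (L * norm (u s - v s)))"
            by (rule ennreal_leI)
          also have "\<dots> = k (t - s) * ennreal (L * norm (u s - v s))"
            using elim t by (simp add: ennreal_mult')
          finally show "ennreal (norm (blinfun_apply (P (t - s)) (N (u s) - N (v s))))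
              \<le> k (t - s) * ennreal (L * norm (u s - v s))" .
        qed
      qed
      finally show "ennreal (norm (u t - v t) - M * norm (u0 - v0))
          \<le> (\<integral>\<^sup>+s. k (t - s) * ennreal (L * norm (u s - v s)) \<partial>lebesgue_on {0<..<t})" .
    qed (use \<open>T > 0\<close> \<open>0 \<le> M\<close> L small t in \<open>auto intro!: continuous_intros cu cv\<close>)
    then show "norm (u t - v t) \<le> C * norm (u0 - v0)"
      by (simp add: C_def mult.assoc)
  qed (use \<open>T > 0\<close> in simp)
  then show "\<exists>C. \<forall>u0 v0 u v. mild_solution S P N T u0 u \<longrightarrow> mild_solution S P N T v0 v \<longrightarrow>
      C_norm T u + C_norm T v \<le> R \<longrightarrow> C_norm T (\<lambda>t. u t - v t) \<le> C * norm (u0 - v0)"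
    by blast
qed

end
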